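(* Let $\mathcal{H}$ be a real vector space of real-valued functions containing the monomials $e_n(x) := x^n$ for all $n \ge 0$ (hence all real polynomials), and let $L : \mathcal{H} \to \mathbb{R}$ be a linear functional. Define \[ a_n := \begin{cases} L(e_n) & n \ge 1,\\ 0 & n = 0,\end{cases} \qquad P_n := -\det(a_{i+j})_{i,j=0}^{n+1}, \qquad Q_n := \det(a_{i+j+2})_{i,j=0}^{n} \] for $n \ge 0$. Suppose that $L((e_1 f)^2) > 0$ for every non-zero real polynomial $f$. Then $Q_n > 0$ for all $n \ge 0$ and \[ L(e_1)^2/L(e_2) = P_0/Q_0 \le P_1/Q_1 \le \dots \le P_n/Q_n \le P_{n+1}/Q_{n+1} \le \dots . \] Suppose in addition that $\mathcal{H}$ is a Hilbert space with inner product $\langle f, g\rangle := L(fg)$, and that $\{e_n\}_{n=1}^\infty$ is complete in $\mathcal{H}$, i.e. if $f \in \mathcal{H}$ satisfies $\langle f, e_n\rangle = 0$ for all $n \ge 1$ then $f = 0$. Then $P_n/Q_n < L(e_0)$ for all $n \ge 0$ and $\lim_{n\to\infty} P_n/Q_n = L(e_0)$.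
   Context: $e_n$ denotes the monomial function $e_n(x) = x^n$; $e_0$ is the constant function $1$. Products such as $e_1 f$ are pointwise products of functions. *)

theory Defs
  imports
    Complex_Main
    "HOL-Library.Function_Algebras"
    "HOL-Computational_Algebra.Polynomial"
    "Jordan_Normal_Form.Determinant"
begin

text \<open>
  A real-valued function on a set \<open>X\<close> of reals is represented by its extension by \<open>0\<close> to all of
  \<open>\<real>\<close>. Pointwise sums, scalar multiples and products of such functions are then the ordinary
  pointwise operations on \<open>real \<Rightarrow> real\<close>, and two such functions agree on \<open>X\<close> iff they are equal.
\<close>

definition functions_on :: "real set \<Rightarrow> (real \<Rightarrow> real) set" where
  "functions_on X = {f. \<forall>x. x \<notin> X \<longrightarrow> f x = 0}"

definition monomial_on :: "real set \<Rightarrow> nat \<Rightarrow> real \<Rightarrow> real" where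
  "monomial_on X n = (\<lambda>x. if x \<in> X then x ^ n else 0)"

definition smult_fun :: "real \<Rightarrow> (real \<Rightarrow> real) \<Rightarrow> real \<Rightarrow> real" where
  "smult_fun c f = (\<lambda>x. c * f x)"

interpretation fun_space: vector_space smult_fun
  by unfold_locales (auto simp: smult_fun_def fun_eq_iff algebra_simps)

definition function_space_on :: "real set \<Rightarrow> (real \<Rightarrow> real) set \<Rightarrow> bool" where
  "function_space_on X H \<longleftrightarrow> H \<subseteq> functions_on X \<and> fun_space.subspace H"

definition linear_functional_on ::
  "(real \<Rightarrow> real) set \<Rightarrow> ((real \<Rightarrow> real) \<Rightarrow> real) \<Rightarrow> bool" where
  "linear_functional_on H L \<longleftrightarrow>
     (\<forall>f\<in>H. \<forall>g\<in>H. L (f + g) = L f + L g) \<and>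
     (\<forall>c. \<forall>f\<in>H. L (smult_fun c f) = c * L f)"

definition inner_product_on ::
  "(real \<Rightarrow> real) set \<Rightarrow> ((real \<Rightarrow> real) \<Rightarrow> (real \<Rightarrow> real) \<Rightarrow> real) \<Rightarrow> bool" where
  "inner_product_on H ip \<longleftrightarrow>
     (\<forall>f\<in>H. \<forall>g\<in>H. ip f g = ip g f) \<and>
     (\<forall>g\<in>H. linear_functional_on H (\<lambda>f. ip f g)) \<and>
     (\<forall>f\<in>H. 0 \<le> ip f f) \<and>
     (\<forall>f\<in>H. ip f f = 0 \<longrightarrow> f = 0)"

definition hilbert_space_on ::
  "(real \<Rightarrow> real) set \<Rightarrow> ((real \<Rightarrow> real) \<Rightarrow> (real \<Rightarrow> real) \<Rightarrow> real) \<Rightarrow> bool" where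
  "hilbert_space_on H ip \<longleftrightarrow>
     fun_space.subspace H \<and>
     inner_product_on H ip \<and>
     (\<forall>s :: nat \<Rightarrow> real \<Rightarrow> real.
        range s \<subseteq> H \<longrightarrow>
        (\<forall>\<epsilon>>0. \<exists>N. \<forall>m\<ge>N. \<forall>n\<ge>N. sqrt (ip (s m - s n) (s m - s n)) < \<epsilon>) \<longrightarrow>
        (\<exists>f\<in>H. (\<lambda>n. sqrt (ip (s n - f) (s n - f))) \<longlonglongrightarrow> 0))"

text \<open>
  The functional is a total HOL function, so \<open>L (f * g)\<close> is meaningful even when the product leaves
  the space \<open>H\<close> (as for \<open>L f = \<integral>f d\<mu>\<close> on a space of square-integrable functions). Requiring products
  to stay in \<open>H\<close> would force \<open>H\<close> to be finite-dimensional once it is a Hilbert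
  space (containing the constant \<open>1\<close>).
\<close>

definition product_form ::
  "((real \<Rightarrow> real) \<Rightarrow> real) \<Rightarrow> (real \<Rightarrow> real) \<Rightarrow> (real \<Rightarrow> real) \<Rightarrow> real" where
  "product_form L f g = L (f * g)"

definition moment :: "real set \<Rightarrow> ((real \<Rightarrow> real) \<Rightarrow> real) \<Rightarrow> nat \<Rightarrow> real" where
  "moment X L n = (if n = 0 then 0 else L (monomial_on X n))"

definition hankel_P :: "real set \<Rightarrow> ((real \<Rightarrow> real) \<Rightarrow> real) \<Rightarrow> nat \<Rightarrow> real" where
  "hankel_P X L n = - det (mat (n + 2) (n + 2) (\<lambda>(i, j). moment X L (i + j)))"

definition hankel_Q :: "real set \<Rightarrow> ((real \<Rightarrow> real) \<Rightarrow> real) \<Rightarrow> nat \<Rightarrow> real" where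
  "hankel_Q X L n = det (mat (n + 1) (n + 1) (\<lambda>(i, j). moment X L (i + j + 2)))"

end

(* Give the polynomials vanishing at 0 the inner product <p, q> = L(pq). Eliminating the first
   column of the bordered determinant shows that P_n / Q_n is the squared length of the orthogonal
   projection of e_0 onto span(e_1, ..., e_(n+1)), where L(q) plays the role of <e_0, q>. These
   subspaces increase with n. In the Hilbert space case none of them contains e_0, and
   completeness makes the projections converge to e_0. *)

theory Submission
  imports Defs
begin

section \<open>Determinants: Schur complements and positive definite matrices\<close>

text \<open>Subtracting from column 0 the combination of the other columns with coefficients
  \<open>c\<close> clears it below the top entry, so the matrix becomes block upper triangular. The
  column operation is multiplication by a unipotent matrix, so no division occurs and an integral
  domain suffices.\<close>

lemma det_mat_Suc_of_solution:
  fixes g :: "nat \<Rightarrow> nat \<Rightarrow> 'a :: idom"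
  assumes c: "\<And>i. i < n \<Longrightarrow> (\<Sum>j<n. g (Suc i) (Suc j) * c j) = g (Suc i) 0"
  shows "det (mat (Suc n) (Suc n) (\<lambda>(i, j). g i j)) =
    (g 0 0 - (\<Sum>j<n. g 0 (Suc j) * c j)) * det (mat n n (\<lambda>(i, j). g (Suc i) (Suc j)))"
proof -
  define M where "M = mat (Suc n) (Suc n) (\<lambda>(i, j). g i j)"
  define U where "U = mat (Suc n) (Suc n)
    (\<lambda>(i, j). if j = 0 then (if i = 0 then 1 else - c (i - 1)) else if i = j then 1 else 0)"
  have "det U = prod_list (diag_mat U)"
    by (rule det_lower_triangular[of "Suc n"]) (auto simp: U_def)
  also have "\<dots> = 1"
    by (auto simp: U_def prod_list_diag_prod intro!: prod.neutral)
  finally have detU: "det U = 1" .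
  let ?s = "g 0 0 - (\<Sum>j<n. g 0 (Suc j) * c j)"
  have entry: "(M * U) $$ (i, j) = (if j = 0 then g i 0 - (\<Sum>k<n. g i (Suc k) * c k) else g i j)"
    if "i < Suc n" "j < Suc n" for i j
  proof -
    have "(M * U) $$ (i, j) = (\<Sum>k<Suc n. g i k * U $$ (k, j))"
      using that by (simp add: M_def U_def scalar_prod_def atLeast0LessThan)
    also have "\<dots> = (if j = 0 then g i 0 - (\<Sum>k<n. g i (Suc k) * c k) else g i j)"
    proof (cases j)
      case 0
      then show ?thesis
        by (simp add: sum.lessThan_Suc_shift U_def sum_negf del: sum.lessThan_Suc)
    next
      case (Suc j')
      have "(\<Sum>k<Suc n. g i k * U $$ (k, j)) = (\<Sum>k<Suc n. if k = j then g i j else 0)"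
        using that Suc by (intro sum.cong) (auto simp: U_def)
      then show ?thesis
        using that Suc by (simp del: sum.lessThan_Suc)
    qed
    finally show ?thesis .
  qed
  have "M * U = four_block_mat (mat 1 1 (\<lambda>_. ?s)) (mat 1 n (\<lambda>(i, j). g 0 (Suc j)))
      (0\<^sub>m n 1) (mat n n (\<lambda>(i, j). g (Suc i) (Suc j)))" (is "_ = ?B")
  proof (rule eq_matI)
    fix i j assume "i < dim_row ?B" "j < dim_col ?B"
    then have ij: "i < Suc n" "j < Suc n" by simp_all
    show "(M * U) $$ (i, j) = ?B $$ (i, j)"
      unfolding entry[OF ij] using ij c[of "i - 1"] by (cases i; cases j) auto
  qed (simp_all add: M_def U_def)
  then have "det (M * U) = ?s * det (mat n n (\<lambda>(i, j). g (Suc i) (Suc j)))"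
    by (simp add: det_four_block_mat_lower_left_zero[where n = 1 and m = n] det_single)
  moreover have "det (M * U) = det M"
    using det_mult[of M "Suc n" U] detU by (simp add: M_def U_def)
  ultimately show ?thesis by (simp add: M_def)
qed

lemma linear_system_solution:
  fixes g :: "nat \<Rightarrow> nat \<Rightarrow> 'a :: field"
  assumes "det (mat n n (\<lambda>(i, j). g i j)) \<noteq> 0"
  obtains c where "\<And>i. i < n \<Longrightarrow> (\<Sum>j<n. g i j * c j) = b i"
proof -
  define A where "A = mat n n (\<lambda>(i, j). g i j)"
  have A: "A \<in> carrier_mat n n" by (simp add: A_def)
  obtain B where B: "B \<in> carrier_mat n n" "A * B = 1\<^sub>m n"
    using det_non_zero_imp_unit[OF A] assms
    unfolding Units_def by (auto simp: A_def ring_mat_def)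
  define v where "v = B *\<^sub>v vec n b"
  have "A *\<^sub>v v = vec n b"
    using A B by (simp add: v_def assoc_mult_mat_vec[symmetric, of A n n B n])
  then have "(A *\<^sub>v v) $ i = b i" if "i < n" for i
    using that by simp
  moreover have "(A *\<^sub>v v) $ i = (\<Sum>j<n. g i j * v $ j)" if "i < n" for i
    using that B by (simp add: A_def v_def scalar_prod_def atLeast0LessThan)
  ultimately show thesis using that[of "\<lambda>j. v $ j"] by simp
qed

text \<open>Induction on the size: the determinant is the Schur complement of the lower right block
  times the determinant of that block, and both factors are positive by a choice of test
  vectors.\<close>

lemma det_pos_if_positive_definite:
  fixes g :: "nat \<Rightarrow> nat \<Rightarrow> real"
  assumes "\<And>v i. i < n \<Longrightarrow> v i \<noteq> 0 \<Longrightarrow> 0 < (\<Sum>i<n. v i * (\<Sum>j<n. g i j * v j))"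
  shows "0 < det (mat n n (\<lambda>(i, j). g i j))"
  using assms
proof (induction n arbitrary: g)
  case 0
  show ?case by (simp add: det_def)
next
  case (Suc n)
  let ?h = "\<lambda>i j. g (Suc i) (Suc j)"
  have h: "0 < det (mat n n (\<lambda>(i, j). ?h i j))"
  proof (rule Suc.IH)
    fix v :: "nat \<Rightarrow> real" and i assume "i < n" "v i \<noteq> 0"
    then show "0 < (\<Sum>i<n. v i * (\<Sum>j<n. ?h i j * v j))"
      \<comment> \<open>A leading 0 restricts the form to the lower right block.\<close>
      using Suc.prems[of "Suc i" "case_nat 0 v"]
      by (simp add: sum.lessThan_Suc_shift del: sum.lessThan_Suc)
  qed
  then obtain c where c: "\<And>i. i < n \<Longrightarrow> (\<Sum>j<n. ?h i j * c j) = g (Suc i) 0"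
    using linear_system_solution[of n ?h "\<lambda>i. g (Suc i) 0"] by auto
  \<comment> \<open>At the vector (1, -c) every component of the matrix product except the first
    vanishes, so the form takes exactly this value.\<close>
  have "0 < g 0 0 - (\<Sum>j<n. g 0 (Suc j) * c j)"
    using Suc.prems[of 0 "case_nat 1 (\<lambda>i. - c i)"] c
    by (simp add: sum.lessThan_Suc_shift sum_negf del: sum.lessThan_Suc)
  then show ?case
    using h by (simp add: det_mat_Suc_of_solution[of n g c, OF c])
qed

section \<open>Positive functionals on polynomials and the projections of 1\<close>

text \<open>Formal polynomials carry the coefficients and degrees used below. Since
  \<open>pCons 0 f\<close> is x times f, \<open>pos\<close> is the positivity hypothesis of the
  theorem.\<close>

locale positive_poly_functional =
  fixes M :: "real poly \<Rightarrow> real"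
  assumes add: "M (p + q) = M p + M q"
    and smult: "M (Polynomial.smult c p) = c * M p"
    and pos: "f \<noteq> 0 \<Longrightarrow> 0 < M (pCons 0 f * pCons 0 f)"
begin

definition hankel_entry :: "nat \<Rightarrow> real" where
  "hankel_entry n = (if n = 0 then 0 else M (monom 1 n))"

text \<open>The Gram determinant of x, ..., x^(n+1) for the form \<open>M (p * q)\<close>.\<close>

definition gram_det :: "nat \<Rightarrow> real" where
  "gram_det n = det (mat (n + 1) (n + 1) (\<lambda>(i, j). hankel_entry (i + j + 2)))"

text \<open>The Gram matrix is bordered by the values of \<open>M\<close> at x, ..., x^(n+1), with 0
  in the corner instead of \<open>M 1\<close>. The sign is opposite to that of
  \<open>hankel_P\<close>.\<close>

definition bordered_det :: "nat \<Rightarrow> real" where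
  "bordered_det n = det (mat (n + 2) (n + 2) (\<lambda>(i, j). hankel_entry (i + j)))"

definition vanishing_polys :: "nat \<Rightarrow> real poly set" where
  "vanishing_polys n = {p. coeff p 0 = 0 \<and> degree p \<le> Suc n}"

lemma zero [simp]: "M 0 = 0"
  using smult[of 0 0] by simp

lemma diff: "M (p - q) = M p - M q"
  using add[of p "Polynomial.smult (-1) q"] smult[of "-1" q] by simp

lemma sum: "M (\<Sum>i\<in>A. f i) = (\<Sum>i\<in>A. M (f i))"
  by (induction A rule: infinite_finite_induct) (simp_all add: add)

lemma monom: "M (monom c n) = c * M (monom 1 n)"
  using smult[of c "monom 1 n"] by (simp add: smult_monom)

lemma pos_if_vanishing:
  assumes "coeff p 0 = 0" "p \<noteq> 0"
  shows "0 < M (p * p)"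
  using pos assms by (cases p) auto

lemma nonneg_if_vanishing: "coeff p 0 = 0 \<Longrightarrow> 0 \<le> M (p * p)"
  using pos_if_vanishing[of p] by (cases "p = 0") auto

text \<open>Translates between polynomials and matrix rows: \<open>k = Suc i\<close> gives row
  \<open>i\<close> of the Gram matrix applied to \<open>c\<close>, and \<open>k = 0\<close> gives
  the border row.\<close>

lemma moment_mult_sum:
  "M (monom 1 k * (\<Sum>j<n. monom (c j) (Suc j))) = (\<Sum>j<n. M (monom 1 (k + Suc j)) * c j)"
proof -
  have "M (monom 1 k * monom (c j) (Suc j)) = M (monom 1 (k + Suc j)) * c j" for j
    using monom[of "c j" "k + Suc j"] by (simp add: mult_monom)
  then show ?thesis by (simp add: sum_distrib_left sum)
qed

lemma diff_square: "M ((p - q) * (p - q)) = M (p * p) - 2 * M (q * p) + M (q * q)"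
proof -
  have "(p - q) * (p - q) = p * p - (q * p + q * p) + q * q"
    by (simp add: algebra_simps)
  then show ?thesis by (simp only: add diff)
qed

lemma vanishing_polys_expand:
  assumes "q \<in> vanishing_polys n"
  shows "q = (\<Sum>j<Suc n. monom (coeff q (Suc j)) (Suc j))"
proof -
  have "q = (\<Sum>j\<le>Suc n. monom (coeff q j) j)"
    using assms poly_as_sum_of_monoms'[of q "Suc n"] by (simp add: vanishing_polys_def)
  also have "\<dots> = (\<Sum>j<Suc n. monom (coeff q (Suc j)) (Suc j))"
    using assms by (simp add: vanishing_polys_def lessThan_Suc_atMost[symmetric]
        sum.lessThan_Suc_shift del: sum.lessThan_Suc)
  finally show ?thesis .
qed

text \<open>The quadratic form of the matrix at \<open>v\<close> is \<open>M (q * q)\<close> for the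
  polynomial \<open>q\<close> with coefficients \<open>v\<close> shifted up by one degree.\<close>

lemma gram_det_pos: "0 < gram_det n"
  unfolding gram_det_def
proof (rule det_pos_if_positive_definite)
  fix v :: "nat \<Rightarrow> real" and i
  assume i: "i < n + 1" "v i \<noteq> 0"
  define q where "q = (\<Sum>j<n + 1. monom (v j) (Suc j))"
  have "coeff q (Suc i) = v i"
    using i by (simp add: q_def coeff_sum del: sum.lessThan_Suc)
  then have "q \<noteq> 0" using i by auto
  moreover have "coeff q 0 = 0"
    by (simp add: q_def coeff_sum)
  ultimately have "0 < M (q * q)"
    by (rule pos_if_vanishing[rotated])
  also have "q * q = (\<Sum>i<n + 1. Polynomial.smult (v i) (monom 1 (Suc i) * q))"
    by (subst q_def)
      (simp add: sum_distrib_right smult_monom del: sum.lessThan_Suc flip: mult_smult_left)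
  also have "M \<dots> = (\<Sum>i<n + 1. v i * (\<Sum>j<n + 1. hankel_entry (i + j + 2) * v j))"
    unfolding q_def sum smult moment_mult_sum by (simp add: hankel_entry_def)
  finally show "0 < (\<Sum>i<n + 1. v i * (\<Sum>j<n + 1. hankel_entry (i + j + 2) * v j))" .
qed

text \<open>The coefficients of the projection solve the normal equations with the Gram matrix. The
  same solution clears the border column, which yields the determinant formula for
  \<open>M p\<close>.\<close>

lemma projection_exists:
  "\<exists>p\<in>vanishing_polys n. M p = - bordered_det n / gram_det n \<and>
    (\<forall>q\<in>vanishing_polys n. M (q * p) = M q)"
proof -
  let ?a = hankel_entry
  obtain c where "\<And>i. i < n + 1 \<Longrightarrow> (\<Sum>j<n + 1. ?a (i + j + 2) * c j) = ?a (i + 1)"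
    using linear_system_solution[of "n + 1" "\<lambda>i j. ?a (i + j + 2)" "\<lambda>i. ?a (i + 1)"]
      gram_det_pos[of n] unfolding gram_det_def by auto
  then have c: "(\<Sum>j<Suc n. ?a (Suc i + Suc j) * c j) = ?a (Suc i + 0)" if "i < Suc n" for i
    using that by simp
  define p where "p = (\<Sum>j<Suc n. monom (c j) (Suc j))"
  have p: "p \<in> vanishing_polys n"
    unfolding p_def vanishing_polys_def
    by (auto simp: coeff_sum intro!: degree_sum_le order_trans[OF degree_monom_le]
        simp del: sum.lessThan_Suc)
  have Mp: "M (monom 1 k * p) = (\<Sum>j<Suc n. ?a (k + Suc j) * c j)" for k
    by (simp only: p_def moment_mult_sum) (simp add: hankel_entry_def)
  have "bordered_det n = (?a 0 - (\<Sum>j<Suc n. ?a (Suc j) * c j)) * gram_det n"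
    using det_mat_Suc_of_solution[of "Suc n" "\<lambda>i j. ?a (i + j)" c, OF c]
    by (simp add: bordered_det_def gram_det_def)
  \<comment> \<open>The corner \<open>?a 0\<close> is 0, and the border row applied to
    \<open>c\<close> is \<open>M p\<close>, by \<open>Mp\<close> at 0.\<close>
  then have "bordered_det n = - M p * gram_det n"
    using Mp[of 0] by (simp add: hankel_entry_def)
  then have "M p = - bordered_det n / gram_det n"
    using gram_det_pos[of n] by (simp add: field_simps)
  moreover have "M (q * p) = M q" if "q \<in> vanishing_polys n" for q
  proof -
    have "M (q * p) = M (\<Sum>i<Suc n. Polynomial.smult (coeff q (Suc i)) (monom 1 (Suc i) * p))"
      by (subst vanishing_polys_expand[OF that])
        (simp add: sum_distrib_right smult_monom del: sum.lessThan_Suc flip: mult_smult_left)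
    also have "\<dots> = (\<Sum>i<Suc n. coeff q (Suc i) * ?a (Suc i))"
      using c by (simp add: sum smult Mp del: sum.lessThan_Suc)
    also have "\<dots> = M (\<Sum>i<Suc n. monom (coeff q (Suc i)) (Suc i))"
      unfolding sum by (intro sum.cong) (simp_all add: hankel_entry_def monom[of "coeff q _"])
    also have "\<dots> = M q"
      using vanishing_polys_expand[OF that] by simp
    finally show ?thesis .
  qed
  ultimately show ?thesis using p by blast
qed

text \<open>
  With respect to the form \<open>M (p * q)\<close>, this is the orthogonal projection of \<open>1\<close> onto the
  polynomials of degree at most \<open>n + 1\<close> vanishing at \<open>0\<close>: there \<open>M q\<close> stands for the inner
  product of \<open>1\<close> and \<open>q\<close>.
\<close>

definition one_proj :: "nat \<Rightarrow> real poly" where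
  "one_proj n = (SOME p. p \<in> vanishing_polys n \<and> M p = - bordered_det n / gram_det n \<and>
    (\<forall>q\<in>vanishing_polys n. M (q * p) = M q))"

lemma one_proj:
  shows one_proj_in: "one_proj n \<in> vanishing_polys n"
    and one_proj_ratio: "M (one_proj n) = - bordered_det n / gram_det n"
    and mult_one_proj: "q \<in> vanishing_polys n \<Longrightarrow> M (q * one_proj n) = M q"
  using someI_ex[OF projection_exists[of n, unfolded Bex_def]] unfolding one_proj_def by blast+

lemma one_proj_coeff_0 [simp]: "coeff (one_proj n) 0 = 0"
  using one_proj_in[of n] by (simp add: vanishing_polys_def)

text \<open>Hence \<open>M (one_proj n)\<close> is the squared length of the projection.\<close>

lemma one_proj_square: "M (one_proj n * one_proj n) = M (one_proj n)"
  by (rule mult_one_proj[OF one_proj_in])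

text \<open>Pythagoras for nested subspaces: the smaller projection lies in the larger subspace, so
  its product with the larger one has the value \<open>M (one_proj m)\<close>.\<close>

lemma one_proj_diff_square:
  assumes "m \<le> n"
  shows "M ((one_proj n - one_proj m) * (one_proj n - one_proj m)) =
    M (one_proj n) - M (one_proj m)"
proof -
  have "one_proj m \<in> vanishing_polys n"
    using one_proj_in[of m] assms by (simp add: vanishing_polys_def)
  from mult_one_proj[OF this] show ?thesis
    by (simp add: diff_square one_proj_square)
qed

lemma one_proj_mono: "m \<le> n \<Longrightarrow> M (one_proj m) \<le> M (one_proj n)"
  using one_proj_diff_square[of m n] nonneg_if_vanishing[of "one_proj n - one_proj m"] by simp

text \<open>A purely algebraic identity. Its sign is not settled here, since \<open>pos\<close>
  concerns only polynomials vanishing at 0.\<close>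

lemma one_minus_one_proj_square:
  "M ((1 - one_proj n) * (1 - one_proj n)) = M 1 - M (one_proj n)"
  by (simp add: diff_square one_proj_square)

end

section \<open>Inner products on function spaces\<close>

text \<open>\<open>inner_product_on\<close> provides linearity in the first argument; symmetry
  carries it over to the second.\<close>

lemma inner_product_on_add_smult:
  assumes ip: "inner_product_on H ip" and H: "fun_space.subspace H"
    and "u \<in> H" "v \<in> H"
  shows "ip (u + smult_fun c v) (u + smult_fun c v) = ip u u + 2 * c * ip u v + c\<^sup>2 * ip v v"
proof -
  define w where "w = u + smult_fun c v"
  have cv: "smult_fun c v \<in> H" and w: "w \<in> H"
    using H assms(3,4) by (simp_all add: w_def fun_space.subspace_def)
  have lin: "ip (u + smult_fun c v) g = ip u g + c * ip v g" if "g \<in> H" for g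
  proof -
    have "ip (u + smult_fun c v) g = ip u g + ip (smult_fun c v) g"
      and "ip (smult_fun c v) g = c * ip v g"
      using ip that assms(3,4) cv
      unfolding inner_product_on_def linear_functional_on_def by blast+
    then show ?thesis by simp
  qed
  have "ip w w = ip w u + c * ip w v"
    using lin[OF w] ip w assms(3,4) by (simp add: w_def[symmetric] inner_product_on_def)
  then show ?thesis
    using lin[OF assms(3)] lin[OF assms(4)] ip assms(3,4)
    by (simp add: w_def inner_product_on_def power2_eq_square algebra_simps)
qed

lemma inner_product_on_Cauchy_Schwarz:
  assumes ip: "inner_product_on H ip" and H: "fun_space.subspace H"
    and u: "u \<in> H" and v: "v \<in> H"
  shows "\<bar>ip u v\<bar> \<le> sqrt (ip u u) * sqrt (ip v v)"
proof (cases "ip v v = 0")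
  case True
  then have "v = 0" using ip v by (simp add: inner_product_on_def)
  then have "ip v u = 0"
    using ip u v unfolding inner_product_on_def linear_functional_on_def
    by (metis add_cancel_right_right)
  then have "ip u v = 0"
    using ip u v by (simp add: inner_product_on_def)
  then show ?thesis by (simp add: True)
next
  case False
  then have v_pos: "0 < ip v v"
    using ip v by (simp add: inner_product_on_def order_less_le)
  \<comment> \<open>This value minimizes the squared length of u + c v.\<close>
  define c where "c = - ip u v / ip v v"
  have "u + smult_fun c v \<in> H"
    using H u v by (simp add: fun_space.subspace_def)
  then have "0 \<le> ip (u + smult_fun c v) (u + smult_fun c v)"
    using ip by (simp add: inner_product_on_def)
  also have "\<dots> = ip u u - (ip u v)\<^sup>2 / ip v v"
    unfolding inner_product_on_add_smult[OF assms]
    using v_pos by (simp add: c_def power2_eq_square field_simps)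
  finally have "(ip u v)\<^sup>2 \<le> ip u u * ip v v"
    using v_pos by (simp add: field_simps)
  then have "sqrt ((ip u v)\<^sup>2) \<le> sqrt (ip u u * ip v v)"
    by (rule real_sqrt_le_mono)
  then show ?thesis by (simp add: real_sqrt_mult)
qed

section \<open>Polynomials as functions on \<open>X\<close>\<close>

definition poly_on :: "real set \<Rightarrow> real poly \<Rightarrow> real \<Rightarrow> real" where
  "poly_on X p = (\<lambda>x. if x \<in> X then poly p x else 0)"

lemma poly_on_add: "poly_on X (p + q) = poly_on X p + poly_on X q"
  and poly_on_diff: "poly_on X (p - q) = poly_on X p - poly_on X q"
  and poly_on_mult: "poly_on X (p * q) = poly_on X p * poly_on X q"
  and poly_on_smult: "poly_on X (Polynomial.smult c p) = smult_fun c (poly_on X p)"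
  and poly_on_0: "poly_on X 0 = 0"
  by (auto simp: poly_on_def smult_fun_def fun_eq_iff)

lemma poly_on_monom: "poly_on X (monom 1 n) = monomial_on X n"
  by (auto simp: poly_on_def monomial_on_def fun_eq_iff poly_monom)

lemma poly_on_pCons_0: "poly_on X (pCons 0 p) = monomial_on X 1 * poly_on X p"
  by (auto simp: poly_on_def monomial_on_def fun_eq_iff)

text \<open>Here \<open>poly f\<close> is not cut off outside \<open>X\<close>, as in the hypothesis
  \<open>positive\<close>; the monomial factor does the cutting.\<close>

lemma monomial_on_1_times_poly: "monomial_on X 1 * poly f = poly_on X (pCons 0 f)"
  by (auto simp: poly_on_def monomial_on_def fun_eq_iff)

lemma poly_on_in_subspace:
  assumes H: "fun_space.subspace H" and monomials: "\<And>n. monomial_on X n \<in> H"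
  shows "poly_on X p \<in> H"
proof -
  have "poly_on X (\<Sum>i\<in>A. monom (c i) i) = (\<Sum>i\<in>A. smult_fun (c i) (monomial_on X i))" for A c
    by (induction A rule: infinite_finite_induct)
      (simp_all add: poly_on_0 poly_on_add smult_monom flip: poly_on_monom poly_on_smult)
  then have "poly_on X p = (\<Sum>i\<le>degree p. smult_fun (coeff p i) (monomial_on X i))"
    by (metis poly_as_sum_of_monoms)
  also have "\<dots> \<in> H"
    using H monomials by (intro fun_space.subspace_sum fun_space.subspace_scale)
  finally show ?thesis .
qed


section \<open>Ratios of Hankel determinants and their limit\<close>

theorem theorem1:
  fixes X :: "real set"
    and H :: "(real \<Rightarrow> real) set"
    and L :: "(real \<Rightarrow> real) \<Rightarrow> real"
  assumes space: "function_space_on X H"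
    and monomials: "\<And>n. monomial_on X n \<in> H"
    and linear: "linear_functional_on H L"
    and positive: "\<And>f :: real poly. f \<noteq> 0 \<Longrightarrow> 0 < L ((monomial_on X 1 * poly f) ^ 2)"
  shows "(\<forall>n. 0 < hankel_Q X L n) \<and>
    L (monomial_on X 1) ^ 2 / L (monomial_on X 2) = hankel_P X L 0 / hankel_Q X L 0 \<and>
    (\<forall>n. hankel_P X L n / hankel_Q X L n \<le> hankel_P X L (Suc n) / hankel_Q X L (Suc n)) \<and>
    (hilbert_space_on H (product_form L) \<and>
     (\<forall>f\<in>H. (\<forall>n\<ge>1. product_form L f (monomial_on X n) = 0) \<longrightarrow> f = 0) \<longrightarrow>
       (\<forall>n. hankel_P X L n / hankel_Q X L n < L (monomial_on X 0)) \<and>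
       (\<lambda>n. hankel_P X L n / hankel_Q X L n) \<longlonglongrightarrow> L (monomial_on X 0))"
proof -
  have H: "fun_space.subspace H"
    using space by (simp add: function_space_on_def)
  note in_H = poly_on_in_subspace[OF H monomials]
  define M where "M = (\<lambda>p. L (poly_on X p))"
  interpret positive_poly_functional M
  proof
    show "M (p + q) = M p + M q" and "M (Polynomial.smult c p) = c * M p" for p q c
      using linear in_H
      by (simp_all add: M_def poly_on_add poly_on_smult linear_functional_on_def)
    show "0 < M (pCons 0 f * pCons 0 f)" if "f \<noteq> 0" for f
      using positive[OF that]
      by (simp only: M_def poly_on_mult monomial_on_1_times_poly power2_eq_square)
  qed
  have M_monom: "M (monom 1 n) = L (monomial_on X n)" for n
    by (simp add: M_def poly_on_monom)
  have moment: "moment X L = hankel_entry"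
    by (auto simp: moment_def hankel_entry_def M_monom)
  have Q: "hankel_Q X L n = gram_det n" for n
    by (simp add: hankel_Q_def gram_det_def moment)
  have ratio: "hankel_P X L n / hankel_Q X L n = M (one_proj n)" for n
    by (simp add: Q one_proj_ratio hankel_P_def bordered_det_def moment)
  have first: "L (monomial_on X 1) ^ 2 / L (monomial_on X 2) = hankel_P X L 0 / hankel_Q X L 0"
  proof -
    let ?a = "moment X L"
    have Q0: "hankel_Q X L 0 = ?a 2"
      by (simp add: hankel_Q_def det_single numeral_2_eq_2)
    then have a2: "?a 2 > 0"
      using gram_det_pos[of 0] by (simp add: Q)
    \<comment> \<open>The system is the single equation \<open>?a 2 * c = ?a 1\<close>, and the
      corner entry is 0.\<close>
    then have "det (mat (Suc 1) (Suc 1) (\<lambda>(i, j). ?a (i + j))) = - (?a 1)\<^sup>2 / ?a 2 * ?a 2"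
      by (subst det_mat_Suc_of_solution[of 1 _ "\<lambda>_. ?a 1 / ?a 2"])
        (simp_all add: det_single numeral_2_eq_2 moment_def[of X L 0])
    then have "hankel_P X L 0 = (?a 1)\<^sup>2"
      using a2 by (simp add: hankel_P_def numeral_2_eq_2)
    then show ?thesis
      using Q0 by (simp add: moment_def)
  qed
  have limit: "(\<forall>n. M (one_proj n) < M 1) \<and> (\<lambda>n. M (one_proj n)) \<longlonglongrightarrow> M 1"
    if hilbert: "hilbert_space_on H (product_form L)"
      and complete: "\<forall>f\<in>H. (\<forall>n\<ge>1. product_form L f (monomial_on X n) = 0) \<longrightarrow> f = 0"
  proof -
    let ?ip = "product_form L"
    define R where "R = (\<lambda>n. M (one_proj n))"
    define s where "s = (\<lambda>n. poly_on X (one_proj n))"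
    have ip: "inner_product_on H ?ip"
      using hilbert by (simp add: hilbert_space_on_def)
    have ip_poly: "?ip (poly_on X p) (poly_on X q) = M (p * q)" for p q
      by (simp add: product_form_def M_def poly_on_mult)
    \<comment> \<open>Distance zero would make \<open>?d\<close> vanish on \<open>X\<close>, hence
      also x times \<open>?d\<close>. This contradicts \<open>pos\<close>, because \<open>?d\<close>
      has constant coefficient 1 and is not the zero polynomial.\<close>
    have bound: "R n < M 1" for n
    proof -
      let ?d = "1 - one_proj n"
      have "?ip (poly_on X ?d) (poly_on X ?d) \<noteq> 0"
      proof
        assume "?ip (poly_on X ?d) (poly_on X ?d) = 0"
        then have "poly_on X ?d = 0"
          using ip in_H by (simp add: inner_product_on_def)
        then have "poly_on X (pCons 0 ?d) = 0"
          by (simp only: poly_on_pCons_0 mult_zero_right)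
        then have "M (pCons 0 ?d * pCons 0 ?d) = 0"
          using zero by (simp only: M_def poly_on_mult poly_on_0 mult_zero_left)
        moreover have "coeff ?d 0 = 1" by simp
        then have "?d \<noteq> 0" by (metis coeff_0 zero_neq_one)
        ultimately show False using pos[of ?d] by simp
      qed
      moreover have "0 \<le> ?ip (poly_on X ?d) (poly_on X ?d)"
        using ip in_H by (simp add: inner_product_on_def)
      ultimately show ?thesis
        by (simp add: ip_poly one_minus_one_proj_square R_def)
    qed
    have "incseq R"
      by (simp add: incseq_def R_def one_proj_mono)
    then have "Cauchy R"
      using incseq_convergent[of R "M 1"] bound by (metis LIMSEQ_imp_Cauchy less_imp_le)
    \<comment> \<open>The Cauchy property thus passes from the bounded increasing real sequence
      \<open>R\<close> to the projections; the absolute value covers both orders of the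
      indices.\<close>
    have dist: "?ip (s m - s n) (s m - s n) = \<bar>R m - R n\<bar>" for m n
    proof -
      have "M ((one_proj m - one_proj n) * (one_proj m - one_proj n)) = \<bar>R m - R n\<bar>"
      proof (cases "n \<le> m")
        case True
        then show ?thesis
          using one_proj_diff_square one_proj_mono by (simp add: R_def)
      next
        case False
        have "(one_proj m - one_proj n) * (one_proj m - one_proj n) =
            (one_proj n - one_proj m) * (one_proj n - one_proj m)"
          by (simp add: algebra_simps)
        then show ?thesis
          using False one_proj_diff_square[of m n] one_proj_mono[of m n] by (simp add: R_def)
      qed
      then show ?thesis
        by (simp add: s_def ip_poly flip: poly_on_diff)
    qed
    have "\<exists>N. \<forall>m\<ge>N. \<forall>n\<ge>N. sqrt (?ip (s m - s n) (s m - s n)) < \<epsilon>"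
      if eps: "0 < \<epsilon>" for \<epsilon>
    proof -
      \<comment> \<open>The square compensates for the root in the norm.\<close>
      obtain N where "\<forall>m\<ge>N. \<forall>n\<ge>N. \<bar>R m - R n\<bar> < \<epsilon>\<^sup>2"
        using metric_CauchyD[OF \<open>Cauchy R\<close> zero_less_power[OF eps, of 2]]
        unfolding dist_real_def by blast
      then have "\<forall>m\<ge>N. \<forall>n\<ge>N. sqrt \<bar>R m - R n\<bar> < \<epsilon>"
        using eps by (auto intro!: real_less_lsqrt)
      then show ?thesis
        unfolding dist by blast
    qed
    moreover have "range s \<subseteq> H"
      using in_H by (auto simp: s_def)
    ultimately obtain f where f: "f \<in> H" "(\<lambda>n. sqrt (?ip (s n - f) (s n - f))) \<longlonglongrightarrow> 0"
      using hilbert unfolding hilbert_space_on_def by blast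
    \<comment> \<open>Completeness identifies the limit \<open>f\<close> with the constant 1 on
      \<open>X\<close>: both have the same inner product with every monomial of degree at least
      1.\<close>
    have "f - poly_on X 1 = 0"
    proof (rule complete[rule_format])
      show "f - poly_on X 1 \<in> H"
        by (intro fun_space.subspace_diff H f in_H)
      fix k :: nat assume k: "1 \<le> k"
      let ?e = "poly_on X (monom 1 k)"
      have lin: "?ip (u - v) ?e = ?ip u ?e - ?ip v ?e" if "u \<in> H" "v \<in> H" for u v
      proof -
        have "?ip ((u - v) + v) ?e = ?ip (u - v) ?e + ?ip v ?e"
          using ip in_H that fun_space.subspace_diff[OF H that]
          unfolding inner_product_on_def linear_functional_on_def by blast
        then show ?thesis by simp
      qed
      \<comment> \<open>Norm convergence implies weak convergence, by Cauchy-Schwarz.\<close>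
      have "(\<lambda>n. ?ip (s n - f) ?e) \<longlonglongrightarrow> 0"
      proof (rule tendsto_0_le[OF f(2)])
        show "\<forall>\<^sub>F n in sequentially. norm (?ip (s n - f) ?e) \<le>
            norm (sqrt (?ip (s n - f) (s n - f))) * sqrt (?ip ?e ?e)"
        proof (rule always_eventually, rule allI)
          fix n
          have "s n - f \<in> H"
            using fun_space.subspace_diff[OF H in_H f(1)] by (simp add: s_def)
          then show "norm (?ip (s n - f) ?e) \<le>
              norm (sqrt (?ip (s n - f) (s n - f))) * sqrt (?ip ?e ?e)"
            using inner_product_on_Cauchy_Schwarz[OF ip H _ in_H, of "s n - f"] ip
            by (simp add: inner_product_on_def)
        qed
      qed
      \<comment> \<open>Once the subspace contains x^k, the projection and 1 have the same product
        with it, so the sequence is eventually constant and its value must be the limit 0.\<close>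
      moreover have "\<forall>\<^sub>F n in sequentially. ?ip (s n - f) ?e = M (monom 1 k) - ?ip f ?e"
      proof (rule eventually_sequentiallyI)
        fix n assume "k \<le> n"
        then have "monom 1 k \<in> vanishing_polys n"
          using k by (auto simp: vanishing_polys_def degree_monom_eq)
        then show "?ip (s n - f) ?e = M (monom 1 k) - ?ip f ?e"
          using in_H f(1) mult_one_proj[of "monom 1 k" n]
          by (simp add: lin s_def ip_poly mult.commute)
      qed
      ultimately have "(\<lambda>n. M (monom 1 k) - ?ip f ?e) \<longlonglongrightarrow> 0"
        by (rule Lim_transform_eventually)
      then have "?ip f ?e = M (monom 1 k)"
        by (simp add: LIMSEQ_const_iff)
      then show "?ip (f - poly_on X 1) (monomial_on X k) = 0"
        using lin[OF f(1) in_H] by (simp add: ip_poly flip: poly_on_monom)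
    qed
    then have "?ip (s n - f) (s n - f) = M 1 - R n" for n
    proof -
      have "?ip (s n - f) (s n - f) = M ((one_proj n - 1) * (one_proj n - 1))"
        using \<open>f - poly_on X 1 = 0\<close> by (simp add: s_def ip_poly flip: poly_on_diff)
      also have "\<dots> = M 1 - R n"
        using one_minus_one_proj_square[of n] by (simp add: R_def algebra_simps)
      finally show ?thesis .
    qed
    \<comment> \<open>Norm convergence to 1 is squared to remove the root; \<open>bound\<close>
      makes the radicand nonnegative, so that square and root cancel.\<close>
    then have "(\<lambda>n. (sqrt (M 1 - R n))\<^sup>2) \<longlonglongrightarrow> 0\<^sup>2"
      using f(2) by (intro tendsto_power) simp
    then have "(\<lambda>n. M 1 - R n) \<longlonglongrightarrow> 0"
      using bound by (simp add: less_imp_le)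
    then have "(\<lambda>n. M 1 - (M 1 - R n)) \<longlonglongrightarrow> M 1 - 0"
      by (intro tendsto_diff tendsto_const)
    then show ?thesis using bound by (simp add: R_def)
  qed
  have M_1: "M 1 = L (monomial_on X 0)"
    using M_monom[of 0] by simp
  then show ?thesis
    unfolding ratio
  proof (intro conjI impI allI)
    show "0 < hankel_Q X L n" for n
      by (simp add: Q gram_det_pos)
    show "L (monomial_on X 1) ^ 2 / L (monomial_on X 2) = M (one_proj 0)"
      using first by (simp only: ratio)
    show "M (one_proj n) \<le> M (one_proj (Suc n))" for n
      by (simp add: one_proj_mono)
  qed (use limit M_1 in auto)
qed

end
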